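(* Let $(X,T)$ be a topological dynamical system, where $X$ is a non-empty compact metric space with metric $d$ and $T:X\to X$ is continuous. Then $(X,T)$ is weak mean equicontinuous if and only if for every $f\in C(X)$ the time average $f^*(x)=\lim_{n\to+\infty}\frac1n\sum_{k=1}^n f(T^kx)$ exists for every $x\in X$ and defines a continuous function $f^*$ on $X$.
   Context: $S_n$ denotes the group of permutations of $\{1,\dots,n\}$; $C(X)$ is the space of continuous functions on $X$. For $x,y\in X$ define $\overline F(x,y)=\limsup_{n\to+\infty}\inf_{\sigma\in S_n}\frac1n\sum_{k=1}^n d(T^kx,T^{\sigma(k)}y)$. $(X,T)$ is $\overline F$-continuous at $x\in X$ if for every $\varepsilon>0$ there is $\delta>0$ such that $\overline F(x,y)<\varepsilon$ whenever $d(x,y)<\delta$. $(X,T)$ is called weak mean equicontinuous (or $\overline F$-continuous) if it is $\overline F$-continuous at every $x\in X$. *)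

theory Defs
  imports "HOL-Analysis.Analysis" "HOL-Combinatorics.Permutations"
begin

text \<open>The phase space is a subset \<open>X\<close> of a metric type, with the induced metric \<^const>\<open>dist\<close>;
  the values of \<open>T\<close> outside \<open>X\<close> are irrelevant. The upper limit is taken in the extended reals,
  because \<^const>\<open>limsup\<close> needs a complete lattice; the infimum of each term is over a finite
  non-empty set of reals. The term at index 0 does not affect the limit.\<close>

definition Fbar :: "('a::metric_space \<Rightarrow> 'a) \<Rightarrow> 'a \<Rightarrow> 'a \<Rightarrow> ereal" where
  "Fbar T x y = limsup (\<lambda>n. ereal (INF \<sigma>\<in>{\<sigma>. \<sigma> permutes {1..n}}.
      (1 / real n) * (\<Sum>k=1..n. dist ((T ^^ k) x) ((T ^^ \<sigma> k) y))))"

definition Fbar_continuous_at :: "'a::metric_space set \<Rightarrow> ('a \<Rightarrow> 'a) \<Rightarrow> 'a \<Rightarrow> bool" where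
  "Fbar_continuous_at X T x \<longleftrightarrow>
     (\<forall>\<epsilon>>0. \<exists>\<delta>>0. \<forall>y\<in>X. dist x y < \<delta> \<longrightarrow> Fbar T x y < ereal \<epsilon>)"

definition weak_mean_equicontinuous :: "'a::metric_space set \<Rightarrow> ('a \<Rightarrow> 'a) \<Rightarrow> bool" where
  "weak_mean_equicontinuous X T \<longleftrightarrow> (\<forall>x\<in>X. Fbar_continuous_at X T x)"

definition birkhoff_average :: "('a \<Rightarrow> 'a) \<Rightarrow> ('a \<Rightarrow> real) \<Rightarrow> nat \<Rightarrow> 'a \<Rightarrow> real" where
  "birkhoff_average T f n x = (1 / real n) * (\<Sum>k=1..n. f ((T ^^ k) x))"

definition time_average :: "('a \<Rightarrow> 'a) \<Rightarrow> ('a \<Rightarrow> real) \<Rightarrow> 'a \<Rightarrow> real" where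
  "time_average T f x = lim (\<lambda>n. birkhoff_average T f n x)"

end

theory Submission
  imports Defs "HOL-Library.Transitive_Closure_Table"
begin

text \<open>The averaged matching distance of two orbit segments controls the difference of their Birkhoff
  averages, by uniform continuity. Hence under weak mean equicontinuity, if the averages of \<open>f\<close> along
  the orbit of \<open>x\<close> exceed \<open>c\<close> infinitely often, then up to an arbitrarily small loss they do so for every
  point of the orbit closure \<open>K\<close>. By compactness of \<open>K\<close> the first such time is bounded, so the orbit splits
  into blocks of bounded length with average about \<open>c\<close>, and the lower limit of the averages at \<open>x\<close> is at
  least \<open>c\<close>. This gives convergence without the ergodic theorem.

  Conversely, call two orbit points close if they are within \<open>3e\<close>. By the defect form of Hall's theorem, an
  optimal matching of two orbit segments leaves few points unmatched unless some set of points of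
  the first segment has too few neighbours in the second. Rounding that set to a finite \<open>e\<close>-net,
  one of finitely many continuous functions then has different averages along the two orbits.\<close>

section \<open>Hall's theorem with deficiency\<close>

text \<open>Only edges into vertices of \<open>xs\<close> occur on the path. This lets a path
  survive a change of the matching away from these vertices.\<close>

lemma rtrancl_path_mono_edges:
  assumes "rtrancl_path r x xs y" and "\<And>u v. v \<in> set xs \<Longrightarrow> r u v \<Longrightarrow> s u v"
  shows "rtrancl_path s x xs y"
  using assms by (induction rule: rtrancl_path.induct) (auto intro: rtrancl_path.intros)

text \<open>A partial matching along \<open>R\<close> is encoded as a permutation that completes it
  arbitrarily; these are the unmatched points.\<close>

definition mismatches :: "('a \<Rightarrow> 'a \<Rightarrow> bool) \<Rightarrow> 'a set \<Rightarrow> ('a \<Rightarrow> 'a) \<Rightarrow> 'a set" where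
  "mismatches R U \<sigma> = {k \<in> U. \<not> R k (\<sigma> k)}"

text \<open>An edge from \<open>i\<close> to \<open>j\<close> means that \<open>i\<close> could take
  over the current partner of \<open>j\<close>. Shifting partners back along the path repairs
  \<open>k\<close>, and \<open>z\<close> takes the partner of \<open>q\<close>, which is free
  because \<open>q\<close> is mismatched anyway. The induction performs this shift one transposition
  at a time.\<close>

lemma augmenting_path:
  assumes "finite U" and "\<sigma> permutes U" and "k \<in> mismatches R U \<sigma>" and "q \<in> mismatches R U \<sigma>"
    and "rtrancl_path (\<lambda>i j. j \<in> U \<and> R i (\<sigma> j)) k ks z" and "distinct (k # ks)" and "R z (\<sigma> q)"
  shows "\<exists>\<tau>. \<tau> permutes U \<and> card (mismatches R U \<tau>) < card (mismatches R U \<sigma>)"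
  using assms(2-)
proof (induction ks arbitrary: k q \<sigma>)
  have fin: "finite (mismatches R U \<rho>)" for \<rho>
    using assms(1) by (simp add: mismatches_def)
  {
    case Nil
    let ?\<tau> = "\<sigma> \<circ> Transposition.transpose k q"
    have z: "z = k" using Nil.prems(4) by (auto elim: rtrancl_path.cases)
    have "q \<noteq> k" using Nil.prems(2,6) z by (auto simp: mismatches_def)
    moreover have "?\<tau> permutes U"
      using Nil.prems by (intro permutes_compose permutes_swap_id) (auto simp: mismatches_def)
    moreover have "mismatches R U ?\<tau> \<subset> mismatches R U \<sigma>"
    proof (rule psubsetI)
      show "mismatches R U ?\<tau> \<subseteq> mismatches R U \<sigma>"
        using Nil.prems(2,3,6) z by (auto simp: mismatches_def Transposition.transpose_def split: if_splits)
      have "k \<notin> mismatches R U ?\<tau>"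
        using Nil.prems(6) z by (simp add: mismatches_def)
      then show "mismatches R U ?\<tau> \<noteq> mismatches R U \<sigma>" using Nil.prems(2) by blast
    qed
    ultimately show ?case using psubset_card_mono[OF fin] by blast
  next
    case (Cons k1 ks)
    \<comment> \<open>Giving \<open>k\<close> the partner of \<open>k1\<close> moves the defect to
      \<open>k1\<close>, where the rest of the path starts.\<close>
    let ?\<tau> = "\<sigma> \<circ> Transposition.transpose k k1"
    have k: "k \<in> U" "\<not> R k (\<sigma> k)" using Cons.prems(2) by (auto simp: mismatches_def)
    have edge: "k1 \<in> U" "R k (\<sigma> k1)" and path: "rtrancl_path (\<lambda>i j. j \<in> U \<and> R i (\<sigma> j)) k1 ks z"
      using Cons.prems(4) by (auto elim: rtrancl_path.cases)
    have dist: "k \<noteq> k1" "k \<notin> set ks" "k1 \<notin> set ks" "distinct (k1 # ks)"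
      using Cons.prems(5) by auto
    have perm: "?\<tau> permutes U"
      using Cons.prems(1) k(1) edge by (intro permutes_compose permutes_swap_id)
    have other: "?\<tau> i = \<sigma> i" if "i \<noteq> k" "i \<noteq> k1" for i
      using that by (simp add: Transposition.transpose_def)
    have at: "?\<tau> k = \<sigma> k1" "?\<tau> k1 = \<sigma> k" by auto
    have kgood: "k \<notin> mismatches R U ?\<tau>" using edge(2) at by (simp add: mismatches_def)
    have sub: "mismatches R U ?\<tau> \<subseteq> insert k1 (mismatches R U \<sigma> - {k})"
    proof
      fix i assume i: "i \<in> mismatches R U ?\<tau>"
      with kgood have "i \<noteq> k" by blast
      with i other[of i] show "i \<in> insert k1 (mismatches R U \<sigma> - {k})"
        by (auto simp: mismatches_def)
    qed
    show ?case
    \<comment> \<open>Unless \<open>k1\<close> becomes a new mismatch, the swap alone lowers the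
      count. If it does, the count has not grown and the induction hypothesis applies to
      \<open>?\<tau>\<close>.\<close>
    proof (cases "k1 \<in> mismatches R U \<sigma> \<or> k1 \<notin> mismatches R U ?\<tau>")
      case True
      then have "mismatches R U ?\<tau> \<subset> mismatches R U \<sigma>"
        using sub dist(1) kgood Cons.prems(2) by blast
      with perm show ?thesis using psubset_card_mono[OF fin] by blast
    next
      case False
      have "card (mismatches R U ?\<tau>) \<le> card (insert k1 (mismatches R U \<sigma> - {k}))"
        by (intro card_mono finite.insertI finite_Diff fin sub)
      also have "\<dots> \<le> Suc (card (mismatches R U \<sigma> - {k}))"
        by (rule card_insert_le_m1) auto
      also have "\<dots> = card (mismatches R U \<sigma>)"
        using Cons.prems(2) fin by (metis card_Suc_Diff1)
      finally have le: "card (mismatches R U ?\<tau>) \<le> card (mismatches R U \<sigma>)" .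
      have path': "rtrancl_path (\<lambda>i j. j \<in> U \<and> R i (?\<tau> j)) k1 ks z"
        using path
      proof (rule rtrancl_path_mono_edges)
        fix u v assume v: "v \<in> set ks" "v \<in> U \<and> R u (\<sigma> v)"
        then have "v \<noteq> k" "v \<noteq> k1" using dist by auto
        then show "v \<in> U \<and> R u (?\<tau> v)" using v(2) other by metis
      qed
      \<comment> \<open>The present holder of the free partner \<open>\<sigma> q\<close>: if
        \<open>q = k\<close>, the swap has just passed it to \<open>k1\<close>.\<close>
      define p where "p = (if q = k then k1 else q)"
      have "q \<noteq> k1" using Cons.prems(3) False by blast
      then have "?\<tau> p = \<sigma> q" using at other[of q] by (simp add: p_def)
      moreover have "p \<in> mismatches R U ?\<tau>"
        using False Cons.prems(3) other[of q] \<open>q \<noteq> k1\<close> by (auto simp: p_def mismatches_def)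
      ultimately have "\<exists>\<rho>. \<rho> permutes U \<and> card (mismatches R U \<rho>) < card (mismatches R U ?\<tau>)"
        using Cons.prems(6) False
        by (intro Cons.IH[OF perm _ _ path' dist(4), of p]) (simp_all del: comp_apply)
      with le show ?thesis using order.strict_trans2 by blast
    qed
  }
qed

text \<open>Take a permutation with the fewest mismatches and let \<open>A\<close> be everything
  reachable from a mismatch by alternating paths. By optimality no augmenting path exists, so all
  neighbours of \<open>A\<close> are partners of matched points of \<open>A\<close>, which leaves at
  most \<open>card A\<close> minus the number of mismatches.\<close>

lemma Hall_deficiency:
  assumes "finite U"
  obtains \<sigma> A where "\<sigma> permutes U" and "A \<subseteq> U"
    and "card {k \<in> U. \<not> R k (\<sigma> k)} + card {l \<in> U. \<exists>k\<in>A. R k l} \<le> card A"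
proof -
  obtain \<sigma> where \<sigma>: "\<sigma> permutes U"
    and opt: "\<And>\<tau>. \<tau> permutes U \<Longrightarrow> card (mismatches R U \<sigma>) \<le> card (mismatches R U \<tau>)"
    using arg_min_nat_lemma[of "\<lambda>\<sigma>. \<sigma> permutes U" id "\<lambda>\<sigma>. card (mismatches R U \<sigma>)"]
      permutes_id by blast
  define E where "E = (\<lambda>i j. j \<in> U \<and> R i (\<sigma> j))"
  define A where "A = {k. \<exists>b \<in> mismatches R U \<sigma>. E\<^sup>*\<^sup>* b k}"
  have bad_A: "mismatches R U \<sigma> \<subseteq> A" by (auto simp: A_def)
  have AU: "A \<subseteq> U"
  proof
    fix k assume "k \<in> A"
    then obtain b where "b \<in> U" "E\<^sup>*\<^sup>* b k" by (auto simp: A_def mismatches_def)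
    from this(2,1) show "k \<in> U" by cases (auto simp: E_def)
  qed
  \<comment> \<open>The holder \<open>j\<close> of a neighbour of \<open>A\<close> extends an
    alternating path, so it lies in \<open>A\<close>; were it mismatched, that path would be
    augmenting.\<close>
  have good: "j \<in> A - mismatches R U \<sigma>" if j: "j \<in> U" and k: "k \<in> A" and R: "R k (\<sigma> j)" for j k
  proof -
    obtain b where b: "b \<in> mismatches R U \<sigma>" "E\<^sup>*\<^sup>* b k" using k by (auto simp: A_def)
    have "E k j" using j R by (simp add: E_def)
    with b have "j \<in> A" by (auto simp: A_def intro: rtranclp.rtrancl_into_rtrancl)
    moreover have "j \<notin> mismatches R U \<sigma>"
    proof
      assume bad: "j \<in> mismatches R U \<sigma>"
      obtain ks0 where "rtrancl_path E b ks0 k" using b(2) by (auto simp: rtranclp_eq_rtrancl_path)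
      then obtain ks where "rtrancl_path E b ks k" "distinct (b # ks)"
        by (rule rtrancl_path_distinct)
      then have "\<exists>\<tau>. \<tau> permutes U \<and> card (mismatches R U \<tau>) < card (mismatches R U \<sigma>)"
        unfolding E_def by (intro augmenting_path[OF assms \<sigma> b(1) bad _ _ R])
      then show False using opt by (auto simp: not_less[symmetric])
    qed
    ultimately show ?thesis by blast
  qed
  have finA: "finite A" using AU assms finite_subset by blast
  have "{l \<in> U. \<exists>k\<in>A. R k l} \<subseteq> \<sigma> ` (A - mismatches R U \<sigma>)"
  proof
    fix l assume "l \<in> {l \<in> U. \<exists>k\<in>A. R k l}"
    then obtain k where "l \<in> U" and k: "k \<in> A" "R k l" by blast
    then obtain j where "j \<in> U" "l = \<sigma> j" using permutes_image[OF \<sigma>] by blast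
    with k show "l \<in> \<sigma> ` (A - mismatches R U \<sigma>)" using good by blast
  qed
  then have "card {l \<in> U. \<exists>k\<in>A. R k l} \<le> card (A - mismatches R U \<sigma>)"
    using finA by (meson card_image_le card_mono finite_Diff finite_imageI le_trans)
  also have "\<dots> = card A - card (mismatches R U \<sigma>)"
    using bad_A finA by (meson card_Diff_subset finite_subset)
  finally have "card (mismatches R U \<sigma>) + card {l \<in> U. \<exists>k\<in>A. R k l} \<le> card A"
    using card_mono[OF finA bad_A] by linarith
  then show ?thesis using that[OF \<sigma> AU] by (simp add: mismatches_def)
qed

section \<open>Matching cost and Birkhoff averages\<close>

text \<open>The sequence under the upper limit in \<open>Fbar\<close>, kept real-valued; its term at
  0 is 0.\<close>

definition match_cost :: "('a::metric_space \<Rightarrow> 'a) \<Rightarrow> 'a \<Rightarrow> 'a \<Rightarrow> nat \<Rightarrow> real" where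
  "match_cost T x y n = (INF \<sigma>\<in>{\<sigma>. \<sigma> permutes {1..n}}.
      (1 / real n) * (\<Sum>k=1..n. dist ((T ^^ k) x) ((T ^^ \<sigma> k) y)))"

lemma Fbar_eq: "Fbar T x y = limsup (\<lambda>n. ereal (match_cost T x y n))"
  by (simp add: Fbar_def match_cost_def)

lemma match_cost_attained:
  obtains \<sigma> where "\<sigma> permutes {1..n}"
    and "match_cost T x y n = (1 / real n) * (\<Sum>k=1..n. dist ((T ^^ k) x) ((T ^^ \<sigma> k) y))"
proof -
  let ?g = "\<lambda>\<sigma>. (1 / real n) * (\<Sum>k=1..n. dist ((T ^^ k) x) ((T ^^ \<sigma> k) y))"
  let ?P = "{\<sigma>. \<sigma> permutes {1..n}}"
  have fin: "finite (?g ` ?P)" and ne: "?g ` ?P \<noteq> {}"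
    using finite_permutations[of "{1..n}"] permutes_id by blast+
  have "match_cost T x y n \<in> ?g ` ?P"
    unfolding match_cost_def cInf_eq_Min[OF fin ne] by (rule Min_in[OF fin ne])
  then show ?thesis using that by blast
qed

lemma match_cost_le:
  assumes "\<sigma> permutes {1..n}"
  shows "match_cost T x y n \<le> (1 / real n) * (\<Sum>k=1..n. dist ((T ^^ k) x) ((T ^^ \<sigma> k) y))"
  unfolding match_cost_def using assms finite_permutations[of "{1..n}"]
  by (intro cINF_lower bdd_below_finite) auto

lemma funpow_in_carrier:
  assumes "T \<in> X \<rightarrow> X" and "x \<in> X"
  shows "(T ^^ k) x \<in> X"
  using assms by (induction k) auto

lemma continuous_on_funpow:
  assumes "T \<in> X \<rightarrow> X" and "continuous_on X T"
  shows "continuous_on X (T ^^ k)"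
proof (induction k)
  case (Suc k)
  have "(T ^^ k) ` X \<subseteq> X" using funpow_in_carrier[OF assms(1)] by blast
  then have "continuous_on X (\<lambda>x. T ((T ^^ k) x))"
    by (rule continuous_on_compose2[OF assms(2) Suc.IH])
  then show ?case by (simp add: o_def)
qed (simp add: id_def)

lemma continuous_on_birkhoff_average:
  assumes "T \<in> X \<rightarrow> X" and "continuous_on X T" and "continuous_on X f"
  shows "continuous_on X (birkhoff_average T f n)"
proof -
  have "continuous_on X (\<lambda>x. f ((T ^^ k) x))" for k
    using funpow_in_carrier[OF assms(1)]
    by (intro continuous_on_compose2[OF assms(3) continuous_on_funpow[OF assms(1,2)]]) blast
  then show ?thesis
    unfolding birkhoff_average_def[abs_def] by (intro continuous_intros)
qed

text \<open>Reordering the orbit of \<open>y\<close> leaves its average unchanged, so an optimal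
  permutation reduces the claim to a pointwise bound. Uniform continuity gives that bound for nearby
  points, boundedness of \<open>f\<close> for distant ones.\<close>

lemma birkhoff_average_diff_le:
  fixes X :: "'a::metric_space set" and f :: "'a \<Rightarrow> real"
  assumes "compact X" and T: "T \<in> X \<rightarrow> X" and "continuous_on X f" and "\<epsilon> > 0"
  obtains C where "C \<ge> 0"
    and "\<And>x y n. x \<in> X \<Longrightarrow> y \<in> X \<Longrightarrow>
      \<bar>birkhoff_average T f n x - birkhoff_average T f n y\<bar> \<le> \<epsilon> + C * match_cost T x y n"
proof -
  obtain \<delta> where "\<delta> > 0"
    and \<delta>: "\<And>a b. a \<in> X \<Longrightarrow> b \<in> X \<Longrightarrow> dist a b < \<delta> \<Longrightarrow> \<bar>f a - f b\<bar> < \<epsilon>"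
    using compact_uniformly_continuous[OF assms(3,1)] \<open>\<epsilon> > 0\<close>
    by (metis uniformly_continuous_on_def dist_real_def)
  obtain M where M: "\<And>a. a \<in> X \<Longrightarrow> \<bar>f a\<bar> \<le> M"
    using compact_imp_bounded[OF compact_continuous_image[OF assms(3,1)]]
    by (auto simp: bounded_iff)
  \<comment> \<open>Chosen so that \<open>C * \<delta>\<close> bounds every difference of values of
    \<open>f\<close>.\<close>
  define C where "C = 2 * \<bar>M\<bar> / \<delta>"
  have C: "C \<ge> 0" using \<open>\<delta> > 0\<close> by (simp add: C_def)
  have ptwise: "\<bar>f a - f b\<bar> \<le> \<epsilon> + C * dist a b" if "a \<in> X" "b \<in> X" for a b
  proof (cases "dist a b < \<delta>")
    case True
    then show ?thesis using \<delta>[OF that] mult_nonneg_nonneg[OF C zero_le_dist[of a b]] by linarith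
  next
    case False
    then have "2 * \<bar>M\<bar> \<le> C * dist a b"
      using \<open>\<delta> > 0\<close> mult_left_mono[of \<delta> "dist a b" "2 * \<bar>M\<bar>"] by (simp add: C_def field_simps)
    then show ?thesis using M[OF that(1)] M[OF that(2)] \<open>\<epsilon> > 0\<close> by linarith
  qed
  have "\<bar>birkhoff_average T f n x - birkhoff_average T f n y\<bar> \<le> \<epsilon> + C * match_cost T x y n"
    if xy: "x \<in> X" "y \<in> X" for x y n
  proof -
    obtain \<sigma> where \<sigma>: "\<sigma> permutes {1..n}"
      and cost: "match_cost T x y n = (1 / real n) * (\<Sum>k=1..n. dist ((T ^^ k) x) ((T ^^ \<sigma> k) y))"
      by (rule match_cost_attained)
    have "birkhoff_average T f n y = (1 / real n) * (\<Sum>k=1..n. f ((T ^^ \<sigma> k) y))"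
      using sum.permute[OF \<sigma>, of "\<lambda>k. f ((T ^^ k) y)"] by (simp add: birkhoff_average_def o_def)
    then have "\<bar>birkhoff_average T f n x - birkhoff_average T f n y\<bar>
        = (1 / real n) * \<bar>\<Sum>k=1..n. f ((T ^^ k) x) - f ((T ^^ \<sigma> k) y)\<bar>"
      by (auto simp add: birkhoff_average_def sum_subtractf abs_mult simp flip: right_diff_distrib diff_divide_distrib)
    also have "\<dots> \<le> (1 / real n) * (\<Sum>k=1..n. \<epsilon> + C * dist ((T ^^ k) x) ((T ^^ \<sigma> k) y))"
      by (intro mult_left_mono sum_abs[THEN order_trans] sum_mono ptwise funpow_in_carrier[OF T] xy) auto
    \<comment> \<open>The quotient stays because it is 0 at \<open>n = 0\<close> and 1
      otherwise.\<close>
    also have "\<dots> = (real n / real n) * \<epsilon> + C * match_cost T x y n"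
      by (simp add: sum.distrib cost sum_distrib_left[symmetric] field_simps add_divide_distrib)
    also have "\<dots> \<le> \<epsilon> + C * match_cost T x y n"
      using \<open>\<epsilon> > 0\<close> by (cases "n = 0") auto
    finally show ?thesis .
  qed
  with C show ?thesis using that by blast
qed

lemma eventually_birkhoff_average_close:
  fixes X :: "'a::metric_space set" and f :: "'a \<Rightarrow> real"
  assumes "compact X" and T: "T \<in> X \<rightarrow> X" and "continuous_on X f"
    and "Fbar_continuous_at X T x" and "x \<in> X" and "\<epsilon> > 0"
  obtains \<delta> where "\<delta> > 0"
    and "\<And>y. y \<in> X \<Longrightarrow> dist x y < \<delta> \<Longrightarrow>
      \<forall>\<^sub>F n in sequentially. \<bar>birkhoff_average T f n x - birkhoff_average T f n y\<bar> < \<epsilon>"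
proof -
  obtain C where C: "C \<ge> 0"
    and le: "\<And>x y n. x \<in> X \<Longrightarrow> y \<in> X \<Longrightarrow>
      \<bar>birkhoff_average T f n x - birkhoff_average T f n y\<bar> \<le> \<epsilon> / 2 + C * match_cost T x y n"
    using birkhoff_average_diff_le[OF assms(1-3), of "\<epsilon> / 2"] \<open>\<epsilon> > 0\<close> by auto
  \<comment> \<open>Makes \<open>C * \<eta>\<close> less than \<open>\<epsilon> / 2\<close>; adding
    1 covers \<open>C = 0\<close>.\<close>
  define \<eta> where "\<eta> = \<epsilon> / (2 * (C + 1))"
  have "\<eta> > 0" using C \<open>\<epsilon> > 0\<close> by (simp add: \<eta>_def)
  then obtain \<delta> where "\<delta> > 0" and \<delta>: "\<And>y. y \<in> X \<Longrightarrow> dist x y < \<delta> \<Longrightarrow> Fbar T x y < ereal \<eta>"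
    using assms(4) unfolding Fbar_continuous_at_def by blast
  have C\<eta>: "C * \<eta> < \<epsilon> / 2"
    using C \<open>\<epsilon> > 0\<close> by (simp add: \<eta>_def field_simps)
  have "\<forall>\<^sub>F n in sequentially. \<bar>birkhoff_average T f n x - birkhoff_average T f n y\<bar> < \<epsilon>"
    if y: "y \<in> X" "dist x y < \<delta>" for y
    using Limsup_lessD[OF \<delta>[OF y, unfolded Fbar_eq]]
  proof eventually_elim
    case (elim n)
    then have "C * match_cost T x y n \<le> C * \<eta>" using C by (intro mult_left_mono) auto
    with C\<eta> le[OF \<open>x \<in> X\<close> y(1), of n] show ?case by linarith
  qed
  with \<open>\<delta> > 0\<close> show ?thesis using that by blast
qed

section \<open>Convergence of the averages by cutting orbits into blocks\<close>

lemma orbit_sum_add: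
  "(\<Sum>k=1..m + n. f ((T ^^ k) x)) = (\<Sum>k=1..m. f ((T ^^ k) x)) + (\<Sum>k=1..n. f ((T ^^ k) ((T ^^ m) x)))"
  for f :: "'a \<Rightarrow> 'b::comm_monoid_add"
proof (induction n)
  case (Suc n)
  have "T ((T ^^ (m + n)) x) = T ((T ^^ n) ((T ^^ m) x))"
    by (metis add.commute comp_apply funpow_add)
  with Suc show ?case by (simp add: add.assoc)
qed simp

text \<open>Cut the orbit greedily into blocks along which the average is at least \<open>c\<close>; only the last,
  incomplete block is uncontrolled.\<close>

lemma orbit_sum_ge:
  fixes f :: "'a \<Rightarrow> real"
  assumes T: "T \<in> K \<rightarrow> K" and M: "\<And>z. z \<in> K \<Longrightarrow> \<bar>f z\<bar> \<le> M"
    and block: "\<And>z. z \<in> K \<Longrightarrow> \<exists>m\<in>{1..N}. (\<Sum>k=1..m. f ((T ^^ k) z)) \<ge> c * real m"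
    and "z \<in> K"
  shows "(\<Sum>k=1..n. f ((T ^^ k) z)) \<ge> c * real n - (M + \<bar>c\<bar>) * real N"
  using \<open>z \<in> K\<close>
proof (induction n arbitrary: z rule: less_induct)
  case (less n)
  have "M \<ge> 0" using M[OF less.prems] by linarith
  show ?case
  proof (cases "n < N")
    case True
    have "- (M * real n) = (\<Sum>k=1..n. - M)" by simp
    also have "\<dots> \<le> (\<Sum>k=1..n. f ((T ^^ k) z))"
      using M[OF funpow_in_carrier[OF T less.prems]] by (intro sum_mono) (smt (verit, best))
    finally have "- (M * real n) \<le> (\<Sum>k=1..n. f ((T ^^ k) z))" .
    moreover have "c * real n \<le> \<bar>c\<bar> * real n" by (intro mult_right_mono) auto
    moreover have "(M + \<bar>c\<bar>) * real n \<le> (M + \<bar>c\<bar>) * real N"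
      using True \<open>M \<ge> 0\<close> by (intro mult_left_mono) auto
    ultimately show ?thesis by (simp add: distrib_right)
  next
    case False
    obtain m where m: "m \<in> {1..N}" "(\<Sum>k=1..m. f ((T ^^ k) z)) \<ge> c * real m"
      using block[OF less.prems] by blast
    \<comment> \<open>The removed block is non-empty and fits into the segment; its average is good,
      so the error term is not increased.\<close>
    define n' where "n' = n - m"
    have n: "n = m + n'" "n' < n" using m(1) False by (auto simp: n'_def)
    have "(\<Sum>k=1..n'. f ((T ^^ k) ((T ^^ m) z))) \<ge> c * real n' - (M + \<bar>c\<bar>) * real N"
      by (rule less.IH[OF n(2) funpow_in_carrier[OF T less.prems]])
    with m(2) show ?thesis
      unfolding n(1) orbit_sum_add by (simp add: distrib_left)
  qed
qed

text \<open>The two orbit sums differ only by \<open>j\<close> terms at either end, a bounded amount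
  that is then divided by \<open>n\<close>.\<close>

lemma birkhoff_average_shift:
  fixes f :: "'a \<Rightarrow> real"
  assumes T: "T \<in> X \<rightarrow> X" and M: "\<And>z. z \<in> X \<Longrightarrow> \<bar>f z\<bar> \<le> M" and "x \<in> X"
  shows "(\<lambda>n. birkhoff_average T f n ((T ^^ j) x) - birkhoff_average T f n x) \<longlonglongrightarrow> 0"
proof (rule Lim_null_comparison)
  have bound: "\<bar>\<Sum>k=1..j. f ((T ^^ k) z)\<bar> \<le> M * real j" if "z \<in> X" for z
  proof -
    have "\<bar>\<Sum>k=1..j. f ((T ^^ k) z)\<bar> \<le> (\<Sum>k=1..j. M)"
      by (intro sum_abs[THEN order_trans] sum_mono M funpow_in_carrier[OF T that])
    then show ?thesis by (simp add: mult.commute)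
  qed
  have "\<bar>birkhoff_average T f n ((T ^^ j) x) - birkhoff_average T f n x\<bar> \<le> 2 * M * real j / real n" for n
  proof -
    have "(\<Sum>k=1..n. f ((T ^^ k) ((T ^^ j) x))) - (\<Sum>k=1..n. f ((T ^^ k) x))
        = (\<Sum>k=1..j. f ((T ^^ k) ((T ^^ n) x))) - (\<Sum>k=1..j. f ((T ^^ k) x))"
      using orbit_sum_add[of f T x j n] orbit_sum_add[of f T x n j] by (simp add: add.commute)
    then have "\<bar>(\<Sum>k=1..n. f ((T ^^ k) ((T ^^ j) x))) - (\<Sum>k=1..n. f ((T ^^ k) x))\<bar> \<le> 2 * M * real j"
      using bound[OF \<open>x \<in> X\<close>] bound[OF funpow_in_carrier[OF T \<open>x \<in> X\<close>, of n]] by linarith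
    then show ?thesis
      by (simp add: birkhoff_average_def divide_right_mono flip: diff_divide_distrib)
  qed
  then show "\<forall>\<^sub>F n in sequentially.
      norm (birkhoff_average T f n ((T ^^ j) x) - birkhoff_average T f n x) \<le> 2 * M * real j / real n"
    by simp
  show "(\<lambda>n. 2 * M * real j / real n) \<longlonglongrightarrow> 0"
    by (rule lim_const_over_n)
qed

text \<open>With two levels strictly between the lower and the upper limit, \<open>osc\<close> would
  push the lower limit up to the smaller level. The bound makes the common limit finite.\<close>

lemma convergent_if_no_oscillation:
  fixes s :: "nat \<Rightarrow> real"
  assumes bound: "\<And>n. \<bar>s n\<bar> \<le> M"
    and osc: "\<And>c c'. c < c' \<Longrightarrow> \<exists>\<^sub>F n in sequentially. s n > c' \<Longrightarrow> \<forall>\<^sub>F n in sequentially. s n \<ge> c"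
  shows "convergent s"
proof -
  let ?s = "\<lambda>n. ereal (s n)"
  have "limsup ?s \<le> liminf ?s"
  proof (rule ccontr)
    assume "\<not> ?thesis"
    then obtain c where c: "liminf ?s < ereal c" "ereal c < limsup ?s"
      using ereal_dense2 by (meson not_le)
    then obtain c' where c': "c < c'" "ereal c' < limsup ?s"
      using ereal_dense2[OF c(2)] by auto
    have "\<exists>\<^sub>F n in sequentially. s n > c'"
    proof (rule ccontr)
      assume "\<not> ?thesis"
      then have "\<forall>\<^sub>F n in sequentially. ?s n \<le> ereal c'"
        by (simp add: not_frequently not_less)
      then have "limsup ?s \<le> ereal c'" by (rule Limsup_bounded)
      with c'(2) show False by simp
    qed
    then have "\<forall>\<^sub>F n in sequentially. ereal c \<le> ?s n" using osc[OF c'(1)] by simp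
    then have "ereal c \<le> liminf ?s" by (rule Liminf_bounded)
    with c(1) show False by simp
  qed
  moreover have "ereal (- M) \<le> liminf ?s"
    using bound by (intro Liminf_bounded always_eventually) (simp add: abs_le_iff minus_le_iff)
  moreover have "limsup ?s \<le> ereal M"
    using bound by (intro Limsup_bounded always_eventually) (simp add: abs_le_iff)
  ultimately obtain L where "limsup ?s \<le> ereal L" "ereal L \<le> liminf ?s"
    by (cases "limsup ?s") auto
  then show ?thesis using limsup_le_liminf_real convergentI by blast
qed

lemma weak_mean_equicontinuous_imp_convergent:
  fixes X :: "'a::metric_space set" and f :: "'a \<Rightarrow> real"
  assumes "compact X" and T: "T \<in> X \<rightarrow> X" "continuous_on X T" and f: "continuous_on X f"
    and weak: "weak_mean_equicontinuous X T" and x: "x \<in> X"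
  shows "convergent (\<lambda>n. birkhoff_average T f n x)"
proof -
  let ?B = "birkhoff_average T f"
  obtain M where M: "\<And>a. a \<in> X \<Longrightarrow> \<bar>f a\<bar> \<le> M"
    using compact_imp_bounded[OF compact_continuous_image[OF f assms(1)]]
    by (auto simp: bounded_iff)
  have "M \<ge> 0" using M[OF x] by linarith
  show ?thesis
  proof (rule convergent_if_no_oscillation)
    fix n
    have "\<bar>\<Sum>k=1..n. f ((T ^^ k) x)\<bar> \<le> (\<Sum>k=1..n. M)"
      by (intro sum_abs[THEN order_trans] sum_mono M funpow_in_carrier[OF T(1) x])
    then show "\<bar>?B n x\<bar> \<le> M"
      using \<open>M \<ge> 0\<close> by (cases "n = 0") (auto simp: birkhoff_average_def field_simps)
  next
    fix c c' :: real
    assume "c < c'" and freq: "\<exists>\<^sub>F n in sequentially. ?B n x > c'"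
    \<comment> \<open>One \<open>e\<close> is lost between \<open>z\<close> and a nearby orbit
      point, one in shifting along the orbit, and one to the incomplete last block.\<close>
    define e where "e = (c' - c) / 4"
    have e: "e > 0" using \<open>c < c'\<close> by (simp add: e_def)
    have c': "c' = c + 4 * e" by (simp add: e_def field_simps)
    define K where "K = closure (range (\<lambda>j. (T ^^ j) x))"
    have orb: "range (\<lambda>j. (T ^^ j) x) \<subseteq> X" using funpow_in_carrier[OF T(1) x] by blast
    have KX: "K \<subseteq> X"
      unfolding K_def by (rule closure_minimal[OF orb compact_imp_closed[OF assms(1)]])
    have "compact K"
      using compact_Int_closed[OF assms(1), of K] KX by (simp add: K_def inf_absorb2)
    have TK: "T \<in> K \<rightarrow> K"
    proof -
      have "T ` K \<subseteq> K" unfolding K_def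
      proof (rule image_closure_subset)
        show "continuous_on (closure (range (\<lambda>j. (T ^^ j) x))) T"
          using T(2) KX K_def continuous_on_subset by blast
        have "T ((T ^^ j) x) \<in> range (\<lambda>j. (T ^^ j) x)" for j
          using rangeI[of "\<lambda>j. (T ^^ j) x" "Suc j"] by simp
        then show "T ` range (\<lambda>j. (T ^^ j) x) \<subseteq> closure (range (\<lambda>j. (T ^^ j) x))"
          using closure_subset by blast
      qed simp
      then show ?thesis by blast
    qed
    have "x \<in> K"
      using rangeI[of "\<lambda>j. (T ^^ j) x" 0] closure_subset unfolding K_def by fastforce
    \<comment> \<open>The times at which the average at \<open>x\<close> is large occur infinitely
      often, so some of them are late enough for both eventual comparisons. Blocks must be
      non-empty, hence \<open>n \<ge> 1\<close>.\<close>
    have reach: "\<exists>n\<ge>1. ?B n z > c + e" if z: "z \<in> K" for z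
    proof -
      have "Fbar_continuous_at X T z" and "z \<in> X"
        using weak KX z by (auto simp: weak_mean_equicontinuous_def)
      then obtain \<delta> where \<delta>: "\<delta> > 0" "\<And>y. y \<in> X \<Longrightarrow> dist z y < \<delta> \<Longrightarrow>
          \<forall>\<^sub>F n in sequentially. \<bar>?B n z - ?B n y\<bar> < e"
        using eventually_birkhoff_average_close[OF assms(1) T(1) f _ _ e] by metis
      then obtain j where "dist z ((T ^^ j) x) < \<delta>"
        using z by (auto simp: K_def closure_approachable dist_commute)
      then have close: "\<forall>\<^sub>F n in sequentially. \<bar>?B n z - ?B n ((T ^^ j) x)\<bar> < e"
        using \<delta>(2) funpow_in_carrier[OF T(1) x] by blast
      have shift: "\<forall>\<^sub>F n in sequentially. \<bar>?B n ((T ^^ j) x) - ?B n x\<bar> < e"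
        using tendstoD[OF birkhoff_average_shift[OF T(1) M x] e] by (simp add: dist_real_def)
      have "\<exists>\<^sub>F n in sequentially. ?B n z > c + e \<and> n \<ge> 1"
        by (rule frequently_rev_mp[OF freq])
          (use close shift eventually_ge_at_top[of 1] in eventually_elim, use c' e in linarith)
      then show ?thesis using frequently_ex by blast
    qed
    \<comment> \<open>The points of \<open>K\<close> with a good block of length \<open>n\<close>
      form a relatively open set; finitely many such lengths then serve all of
      \<open>K\<close>.\<close>
    have "\<exists>U. open U \<and> U \<inter> K = ?B n -` {c + e<..} \<inter> K" for n
    proof -
      have "continuous_on K (?B n)"
        by (rule continuous_on_subset[OF continuous_on_birkhoff_average[OF T f] KX])
      then show ?thesis
        using open_greaterThan[of "c + e"] unfolding continuous_on_open_invariant by blast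
    qed
    then obtain U where U: "\<And>n. open (U n)" "\<And>n. U n \<inter> K = ?B n -` {c + e<..} \<inter> K"
      by metis
    have "K \<subseteq> (\<Union>n\<in>{1..}. U n)"
    proof
      fix z assume z: "z \<in> K"
      then obtain n where "n \<ge> 1" "z \<in> ?B n -` {c + e<..} \<inter> K" using reach by auto
      then show "z \<in> (\<Union>n\<in>{1..}. U n)" using U(2)[of n] by auto
    qed
    then obtain D where D: "D \<subseteq> {1..}" "finite D" "K \<subseteq> (\<Union>n\<in>D. U n)"
      using compactE_image[OF \<open>compact K\<close>, of "{1..}" U] U(1) by metis
    define N where "N = Max D"
    have block: "\<exists>m\<in>{1..N}. (\<Sum>k=1..m. f ((T ^^ k) z)) \<ge> (c + e) * real m" if z: "z \<in> K" for z
    proof -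
      obtain m where m: "m \<in> D" "z \<in> U m" using D(3) z by blast
      then have "?B m z > c + e" using U(2)[of m] z by auto
      moreover have "m \<in> {1..N}" using m D by (auto simp: N_def)
      ultimately show ?thesis
        by (intro bexI[of _ m]) (auto simp: birkhoff_average_def field_simps)
    qed
    let ?C = "(M + \<bar>c + e\<bar>) * real N"
    have lower: "(\<Sum>k=1..n. f ((T ^^ k) x)) \<ge> (c + e) * real n - ?C" for n
      using M KX by (intro orbit_sum_ge[OF TK _ block \<open>x \<in> K\<close>]) auto
    \<comment> \<open>The loss from the incomplete block does not depend on \<open>n\<close>, so it
      eventually costs less than \<open>e\<close> on average.\<close>
    have "(\<lambda>n. ?C / real n) \<longlonglongrightarrow> 0" by (rule lim_const_over_n)
    from order_tendstoD(2)[OF this e] eventually_gt_at_top[of 0]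
    show "\<forall>\<^sub>F n in sequentially. ?B n x \<ge> c"
    proof eventually_elim
      case (elim n)
      then have "?C < e * real n" by (simp add: field_simps)
      with lower[of n] have "(\<Sum>k=1..n. f ((T ^^ k) x)) \<ge> c * real n"
        by (simp add: distrib_right)
      with elim show ?case by (simp add: birkhoff_average_def field_simps)
    qed
  qed
qed

section \<open>Continuity of the time average\<close>

lemma weak_mean_equicontinuous_imp_continuous:
  fixes X :: "'a::metric_space set" and f :: "'a \<Rightarrow> real"
  assumes "compact X" and T: "T \<in> X \<rightarrow> X" "continuous_on X T" and f: "continuous_on X f"
    and weak: "weak_mean_equicontinuous X T"
  shows "continuous_on X (time_average T f)"
  unfolding continuous_on_iff
proof (intro ballI allI impI)
  fix x and e :: real
  assume x: "x \<in> X" and "e > 0"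
  have lim: "(\<lambda>n. birkhoff_average T f n z) \<longlonglongrightarrow> time_average T f z" if "z \<in> X" for z
    using weak_mean_equicontinuous_imp_convergent[OF assms that]
    by (simp add: time_average_def convergent_LIMSEQ_iff)
  have "Fbar_continuous_at X T x" using weak x by (simp add: weak_mean_equicontinuous_def)
  then obtain \<delta> where \<delta>: "\<delta> > 0" "\<And>y. y \<in> X \<Longrightarrow> dist x y < \<delta> \<Longrightarrow>
      \<forall>\<^sub>F n in sequentially. \<bar>birkhoff_average T f n x - birkhoff_average T f n y\<bar> < e / 2"
    using eventually_birkhoff_average_close[OF assms(1) T(1) f _ x, of "e / 2"] \<open>e > 0\<close>
    by (metis half_gt_zero)
  have "dist (time_average T f y) (time_average T f x) < e" if y: "y \<in> X" "dist y x < \<delta>" for y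
  proof -
    \<comment> \<open>Only a non-strict inequality survives the limit, hence
      \<open>e / 2\<close>.\<close>
    have "\<bar>time_average T f x - time_average T f y\<bar> \<le> e / 2"
    proof (rule tendsto_upperbound)
      show "(\<lambda>n. \<bar>birkhoff_average T f n x - birkhoff_average T f n y\<bar>)
          \<longlonglongrightarrow> \<bar>time_average T f x - time_average T f y\<bar>"
        by (intro tendsto_intros lim x y)
      show "\<forall>\<^sub>F n in sequentially. \<bar>birkhoff_average T f n x - birkhoff_average T f n y\<bar> \<le> e / 2"
        using \<delta>(2)[of y] y by (auto simp: dist_commute elim: eventually_mono)
    qed simp
    with \<open>e > 0\<close> show ?thesis by (simp add: dist_real_def abs_minus_commute)
  qed
  with \<delta>(1) show "\<exists>d>0. \<forall>x'\<in>X. dist x' x < d \<longrightarrow> dist (time_average T f x') (time_average T f x) < e"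
    by blast
qed

section \<open>Matching orbits by bump functions\<close>

text \<open>For finite \<open>S\<close> and positive \<open>e\<close>, a continuous cutoff equal to
  1 within \<open>e\<close> of \<open>S\<close> and to 0 at distance \<open>2 * e\<close> or more.
  The product form gives the zero function for empty \<open>S\<close>.\<close>

definition bump :: "real \<Rightarrow> 'a::metric_space set \<Rightarrow> 'a \<Rightarrow> real" where
  "bump e S z = 1 - (\<Prod>c\<in>S. 1 - max 0 (min 1 (2 - dist z c / e)))"

lemma continuous_on_bump: "continuous_on A (bump e S)"
  unfolding bump_def[abs_def] divide_inverse by (intro continuous_intros)

lemma bump_bounds: "0 \<le> bump e S z" "bump e S z \<le> 1"
  unfolding bump_def
  by (auto intro!: prod_le_1 prod_nonneg)

lemma bump_eq_1:
  assumes "finite S" and "c \<in> S" and "dist z c < e"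
  shows "bump e S z = 1"
proof -
  have "e > 0" using assms(3) zero_le_dist[of z c] by linarith
  then have "dist z c / e < 1" using assms(3) by simp
  then have "1 - max 0 (min 1 (2 - dist z c / e)) = 0" by simp
  then show ?thesis unfolding bump_def using assms(1,2) by auto
qed

lemma bump_eq_0:
  assumes "e > 0" and "\<And>c. c \<in> S \<Longrightarrow> dist z c \<ge> 2 * e"
  shows "bump e S z = 0"
proof -
  have "1 - max 0 (min 1 (2 - dist z c / e)) = 1" if "c \<in> S" for c
    using assms(2)[OF that] \<open>e > 0\<close> by (simp add: field_simps)
  then show ?thesis by (simp add: bump_def)
qed

text \<open>The deficient set of the Hall-type lemma is seen by one of the finitely many bump functions
  on subsets of the net, so comparing their averages bounds the number of badly matched points.\<close>

lemma match_cost_le_if_bump_averages_close: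
  fixes X :: "'a::metric_space set"
  assumes T: "T \<in> X \<rightarrow> X" and x: "x \<in> X" and y: "y \<in> X" and "e > 0" and "n \<ge> 1"
    and net: "finite C" "X \<subseteq> (\<Union>c\<in>C. ball c e)"
    and D: "\<And>a b. a \<in> X \<Longrightarrow> b \<in> X \<Longrightarrow> dist a b \<le> D"
    and close: "\<And>S. S \<subseteq> C \<Longrightarrow>
      birkhoff_average T (bump e S) n x \<le> birkhoff_average T (bump e S) n y + \<eta>"
  shows "match_cost T x y n \<le> 3 * e + D * \<eta>"
proof -
  \<comment> \<open>The radius is \<open>e\<close> from a point to the net plus \<open>2 * e\<close>
    for the support of the bump.\<close>
  define R where "R k l \<longleftrightarrow> dist ((T ^^ k) x) ((T ^^ l) y) < 3 * e" for k l
  obtain \<sigma> A where \<sigma>: "\<sigma> permutes {1..n}" and A: "A \<subseteq> {1..n}"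
    and defect: "card {k \<in> {1..n}. \<not> R k (\<sigma> k)} + card {l \<in> {1..n}. \<exists>k\<in>A. R k l} \<le> card A"
    using Hall_deficiency[of "{1..n}" R] by auto
  \<comment> \<open>Rounding the deficient set to the net leaves finitely many candidates, whatever
    \<open>n\<close> is. Its bump is 1 on the points of \<open>A\<close> and vanishes at
    \<open>(T ^^ l) y\<close> unless \<open>l\<close> is a neighbour of \<open>A\<close>.\<close>
  define S where "S = {c \<in> C. \<exists>k\<in>A. dist ((T ^^ k) x) c < e}"
  have S: "S \<subseteq> C" "finite S" using net(1) by (auto simp: S_def)
  let ?bad = "{k \<in> {1..n}. \<not> R k (\<sigma> k)}" and ?N = "{l \<in> {1..n}. \<exists>k\<in>A. R k l}"
  have "real (card A) = (\<Sum>k\<in>A. bump e S ((T ^^ k) x))"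
  proof -
    have "bump e S ((T ^^ k) x) = 1" if "k \<in> A" for k
    proof -
      obtain c where "c \<in> C" "dist ((T ^^ k) x) c < e"
        using net(2) funpow_in_carrier[OF T x, of k] by (force simp: dist_commute)
      with that show ?thesis by (intro bump_eq_1[OF S(2)]) (auto simp: S_def)
    qed
    then show ?thesis by simp
  qed
  also have "\<dots> \<le> (\<Sum>k=1..n. bump e S ((T ^^ k) x))"
    using A by (intro sum_mono2) (auto intro: bump_bounds)
  also have "\<dots> \<le> (\<Sum>l=1..n. bump e S ((T ^^ l) y)) + \<eta> * real n"
    using close[OF S(1)] \<open>n \<ge> 1\<close> by (simp add: birkhoff_average_def field_simps)
  also have "(\<Sum>l=1..n. bump e S ((T ^^ l) y)) \<le> (\<Sum>l=1..n. if l \<in> ?N then 1 else 0)"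
  proof (rule sum_mono)
    fix l assume l: "l \<in> {1..n}"
    show "bump e S ((T ^^ l) y) \<le> (if l \<in> ?N then 1 else 0)"
    proof (cases "l \<in> ?N")
      case False
      have "bump e S ((T ^^ l) y) = 0"
      proof (rule bump_eq_0[OF \<open>e > 0\<close>], rule ccontr)
        fix c assume "c \<in> S" and "\<not> 2 * e \<le> dist ((T ^^ l) y) c"
        then obtain k where "k \<in> A" "dist ((T ^^ k) x) c < e" "dist ((T ^^ l) y) c < 2 * e"
          by (auto simp: S_def)
        then have "k \<in> A" "R k l"
          using dist_triangle2[of "(T ^^ k) x" "(T ^^ l) y" c] by (auto simp: R_def)
        with False l show False by blast
      qed
      then show ?thesis using False by simp
    qed (use bump_bounds in auto)
  qed
  also have "(\<Sum>l=1..n. if l \<in> ?N then 1 else 0) = real (card ?N)"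
    by (simp add: sum.If_cases Int_def)
  finally have bad: "real (card ?bad) \<le> \<eta> * real n"
    using defect by linarith
  have "D \<ge> 0" using D[OF x x] by simp
  \<comment> \<open>Matched pairs cost less than \<open>3 * e\<close>, the few others at most the
    diameter bound \<open>D\<close>.\<close>
  have "(\<Sum>k=1..n. dist ((T ^^ k) x) ((T ^^ \<sigma> k) y)) \<le> (\<Sum>k=1..n. 3 * e + (if k \<in> ?bad then D else 0))"
  proof (rule sum_mono)
    fix k assume k: "k \<in> {1..n}"
    show "dist ((T ^^ k) x) ((T ^^ \<sigma> k) y) \<le> 3 * e + (if k \<in> ?bad then D else 0)"
      using D[OF funpow_in_carrier[OF T x, of k] funpow_in_carrier[OF T y, of "\<sigma> k"]] k \<open>e > 0\<close>
      by (auto simp: R_def)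
  qed
  also have "\<dots> = 3 * e * real n + D * real (card ?bad)"
    by (simp add: sum.distrib sum.If_cases Int_def mult.commute)
  also have "\<dots> \<le> 3 * e * real n + D * (\<eta> * real n)"
    using bad \<open>D \<ge> 0\<close> by (intro add_left_mono mult_left_mono)
  finally have "(1 / real n) * (\<Sum>k=1..n. dist ((T ^^ k) x) ((T ^^ \<sigma> k) y)) \<le> 3 * e + D * \<eta>"
    using \<open>n \<ge> 1\<close> by (simp add: field_simps)
  with match_cost_le[OF \<sigma>] show ?thesis by (rule order_trans)
qed

section \<open>From continuous time averages to weak mean equicontinuity\<close>

lemma continuous_averages_imp_weak_mean_equicontinuous:
  fixes X :: "'a::metric_space set"
  assumes "compact X" and T: "T \<in> X \<rightarrow> X"
    and conv: "\<And>(f :: 'a \<Rightarrow> real) x. continuous_on X f \<Longrightarrow> x \<in> X \<Longrightarrow>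
      convergent (\<lambda>n. birkhoff_average T f n x)"
    and cont: "\<And>f :: 'a \<Rightarrow> real. continuous_on X f \<Longrightarrow> continuous_on X (time_average T f)"
  shows "weak_mean_equicontinuous X T"
  unfolding weak_mean_equicontinuous_def Fbar_continuous_at_def
proof (intro ballI allI impI)
  fix x and \<epsilon> :: real
  assume x: "x \<in> X" and "\<epsilon> > 0"
  have lim: "(\<lambda>n. birkhoff_average T f n z) \<longlonglongrightarrow> time_average T f z"
    if "continuous_on X f" "z \<in> X" for f :: "'a \<Rightarrow> real" and z
    using conv[OF that] by (simp add: time_average_def convergent_LIMSEQ_iff)
  obtain D where D: "\<And>a b. a \<in> X \<Longrightarrow> b \<in> X \<Longrightarrow> dist a b \<le> D"
    using compact_imp_bounded[OF assms(1)] bounded_two_points by metis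
  have "D \<ge> 0" using D[OF x x] by simp
  \<comment> \<open>With these constants \<open>3 * e\<close> is \<open>\<epsilon> / 4\<close> and
    \<open>D * \<eta>\<close> is below \<open>\<epsilon> / 4\<close>, which leaves room for the
    non-strict bound on the upper limit.\<close>
  define e where "e = \<epsilon> / 12"
  define \<eta> where "\<eta> = \<epsilon> / (4 * (D + 1))"
  have pos: "e > 0" "\<eta> > 0" using \<open>\<epsilon> > 0\<close> \<open>D \<ge> 0\<close> by (simp_all add: e_def \<eta>_def)
  have small: "3 * e + D * \<eta> < \<epsilon> / 2 + \<epsilon> / 4"
  proof -
    have "D * \<eta> < \<epsilon> / 4" using \<open>\<epsilon> > 0\<close> \<open>D \<ge> 0\<close> by (simp add: \<eta>_def field_simps)
    then show ?thesis using \<open>\<epsilon> > 0\<close> by (simp add: e_def)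
  qed
  obtain C where C: "finite C" "X \<subseteq> (\<Union>c\<in>C. ball c e)"
    using compactE_image[OF assms(1), of X "\<lambda>c. ball c e"] pos(1)
    by (metis UN_I centre_in_ball open_ball subsetI)
  have "\<forall>\<^sub>F y in at x within X. \<bar>time_average T (bump e S) y - time_average T (bump e S) x\<bar> < \<eta>" for S
  proof -
    have "(time_average T (bump e S) \<longlongrightarrow> time_average T (bump e S) x) (at x within X)"
      using cont[OF continuous_on_bump] x by (auto simp: continuous_on)
    from tendstoD[OF this pos(2)] show ?thesis by (simp add: dist_real_def)
  qed
  \<comment> \<open>The net has finitely many subsets, so one neighbourhood of \<open>x\<close>
    serves all bumps. The filter omits \<open>x\<close> itself, so \<open>y = x\<close> is treated
    separately below.\<close>
  then have "\<forall>\<^sub>F y in at x within X. \<forall>S\<in>Pow C.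
      \<bar>time_average T (bump e S) y - time_average T (bump e S) x\<bar> < \<eta>"
    using C(1) by (simp add: eventually_ball_finite)
  then obtain \<delta> where "\<delta> > 0" and \<delta>: "\<And>y S. y \<in> X \<Longrightarrow> y \<noteq> x \<Longrightarrow> dist y x < \<delta> \<Longrightarrow> S \<subseteq> C \<Longrightarrow>
      \<bar>time_average T (bump e S) y - time_average T (bump e S) x\<bar> < \<eta>"
    unfolding eventually_at by blast
  have "Fbar T x y < ereal \<epsilon>" if y: "y \<in> X" "dist x y < \<delta>" for y
  proof -
    have "\<forall>\<^sub>F n in sequentially.
        birkhoff_average T (bump e S) n x < birkhoff_average T (bump e S) n y + \<eta>" if S: "S \<subseteq> C" for S
    proof -
      have "time_average T (bump e S) x - time_average T (bump e S) y < \<eta>"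
        using \<delta>[OF y(1) _ _ S] y(2) pos(2) by (cases "y = x") (auto simp: dist_commute abs_less_iff)
      moreover have "(\<lambda>n. birkhoff_average T (bump e S) n x - birkhoff_average T (bump e S) n y)
          \<longlonglongrightarrow> time_average T (bump e S) x - time_average T (bump e S) y"
        by (intro tendsto_diff lim continuous_on_bump x y)
      ultimately have "\<forall>\<^sub>F n in sequentially.
          birkhoff_average T (bump e S) n x - birkhoff_average T (bump e S) n y < \<eta>"
        by (simp add: order_tendstoD(2))
      then show ?thesis by eventually_elim linarith
    qed
    then have "\<forall>\<^sub>F n in sequentially. \<forall>S\<in>Pow C.
        birkhoff_average T (bump e S) n x < birkhoff_average T (bump e S) n y + \<eta>"
      using C(1) by (simp add: eventually_ball_finite)
    then have "\<forall>\<^sub>F n in sequentially. ereal (match_cost T x y n) \<le> ereal (\<epsilon> / 2 + \<epsilon> / 4)"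
      using eventually_ge_at_top[of 1]
    proof eventually_elim
      case (elim n)
      then have "match_cost T x y n \<le> 3 * e + D * \<eta>"
        by (intro match_cost_le_if_bump_averages_close[OF T x y(1) pos(1) _ C D]) (auto intro: less_imp_le)
      with small show ?case by simp
    qed
    then have "Fbar T x y \<le> ereal (\<epsilon> / 2 + \<epsilon> / 4)"
      unfolding Fbar_eq by (rule Limsup_bounded)
    also have "\<dots> < ereal \<epsilon>" using \<open>\<epsilon> > 0\<close> by simp
    finally show ?thesis .
  qed
  with \<open>\<delta> > 0\<close> show "\<exists>\<delta>>0. \<forall>y\<in>X. dist x y < \<delta> \<longrightarrow> Fbar T x y < ereal \<epsilon>" by blast
qed

theorem theorem1p3:
  fixes X :: "'a::metric_space set" and T :: "'a \<Rightarrow> 'a"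
  assumes "compact X" and "X \<noteq> {}"
    and "T \<in> X \<rightarrow> X" and "continuous_on X T"
  shows "weak_mean_equicontinuous X T \<longleftrightarrow>
    (\<forall>f :: 'a \<Rightarrow> real. continuous_on X f \<longrightarrow>
       (\<forall>x\<in>X. convergent (\<lambda>n. birkhoff_average T f n x)) \<and>
       continuous_on X (time_average T f))"
proof
  assume "weak_mean_equicontinuous X T"
  then show "\<forall>f :: 'a \<Rightarrow> real. continuous_on X f \<longrightarrow>
       (\<forall>x\<in>X. convergent (\<lambda>n. birkhoff_average T f n x)) \<and>
       continuous_on X (time_average T f)"
    using weak_mean_equicontinuous_imp_convergent[OF assms(1,3,4)]
      weak_mean_equicontinuous_imp_continuous[OF assms(1,3,4)] by blast
next
  assume "\<forall>f :: 'a \<Rightarrow> real. continuous_on X f \<longrightarrow>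
       (\<forall>x\<in>X. convergent (\<lambda>n. birkhoff_average T f n x)) \<and>
       continuous_on X (time_average T f)"
  then show "weak_mean_equicontinuous X T"
    by (intro continuous_averages_imp_weak_mean_equicontinuous[OF assms(1,3)]) blast+
qed

end
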